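(* Let $\Delta\subset\mathbb R$ be the compact support of two perfect systems $(w_1,w_2,\mathrm d\mu)$, with $\int_\Delta w_1(x)\,\mathrm d\mu(x)=1$, and $(\hat w_1,\hat w_2,\mathrm d\mu)$, with $\int_\Delta\hat w_1(x)\,\mathrm d\mu(x)=1$, that have the same sequence of type II multiple orthogonal polynomials $\{B^{(n)}(x)\}_{n=0}^\infty$. Then $\hat w_1=w_1$ and there exist $\alpha,\beta,\gamma\in\mathbb R$, $\alpha,\beta\neq0$, such that $$\gamma w_1+\alpha w_2+\beta\hat w_2=0 .$$ If $A_1^{(m)},A_2^{(m)}$ are the type I multiple orthogonal polynomials associated with $(w_1,w_2,\mathrm d\mu)$, then the type I multiple orthogonal polynomials $\hat A_1^{(m)},\hat A_2^{(m)}$ associated with $(w_1,\hat w_2,\mathrm d\mu)$ are given by $$\hat A_1^{(m)}=A_1^{(m)}-\frac{\gamma}{\alpha}A_2^{(m)},\qquad \hat A_2^{(m)}=-\frac{\beta}{\alpha}A_2^{(m)},$$ and both systems have the same linear forms: $\hat Q^{(m)}=Q^{(m)}$, where $Q^{(m)}:=w_1A_1^{(m)}+w_2A_2^{(m)}$ and $\hat Q^{(m)}:=w_1\hat A_1^{(m)}+\hat w_2\hat A_2^{(m)}$, for all $m\in\mathbb N_0$.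
   Context: $\mu$ is a measure on $\Delta$ and the weights are real functions on $\Delta$ with finite moments. Equality of weights is understood $\mu$-almost everywhere (equality as weights for $\mu$). All vectors and matrices are semi-infinite, indexed by $0,1,2,\dots$. Put $X(x)=(1,x,x^2,\dots)^\top$, $X_1(x)=(1,0,x,0,x^2,0,\dots)^\top$, $X_2(x)=(0,1,0,x,0,x^2,\dots)^\top$. For a system $(w_1,w_2,\mathrm d\mu)$ the moment matrix is $g=\int_\Delta X(x)\big(X_1(x)w_1(x)+X_2(x)w_2(x)\big)^\top\mathrm d\mu(x)$. The system is called perfect if $g$ has a Gauss–Borel factorization $g=S^{-1}H\tilde S^{-\top}$ with $S,\tilde S$ lower unitriangular and $H=\operatorname{diag}(H_0,H_1,\dots)$, all $H_n\ne0$. The type II polynomials $B^{(n)}$ are the entries of $B=SX$ ($B^{(n)}$ is monic of degree $n$), and the type I polynomials $A_a^{(n)}$ are the entries of $A_a=H^{-1}\tilde SX_a$, $a\in\{1,2\}$. *)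

theory Defs
  imports "HOL-Analysis.Analysis" "HOL-Computational_Algebra.Polynomial"
begin

text \<open>Measures, their support, and weights. The topology is the one of the real line, so a measure
  on a subset of the line has \<^term>\<open>U \<inter> space M\<close> as its relatively open sets.\<close>

definition measure_support :: "real measure \<Rightarrow> real set" where
  "measure_support M = {x \<in> space M. \<forall>U. open U \<and> x \<in> U \<longrightarrow> emeasure M (U \<inter> space M) \<noteq> 0}"

definition is_weight :: "real measure \<Rightarrow> (real \<Rightarrow> real) \<Rightarrow> bool" where
  "is_weight M w \<longleftrightarrow> (\<forall>k. integrable M (\<lambda>x. x ^ k * w x))"

text \<open>Semi-infinite matrices. The product and the matrix-vector product below are the usual ones
  whenever the left factor is lower triangular, which is the only case in which they are used.\<close>

type_synonym smat = "nat \<Rightarrow> nat \<Rightarrow> real"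

definition lower_unitriangular :: "smat \<Rightarrow> bool" where
  "lower_unitriangular S \<longleftrightarrow> (\<forall>i. S i i = 1) \<and> (\<forall>i j. i < j \<longrightarrow> S i j = 0)"

definition sdiag :: "(nat \<Rightarrow> real) \<Rightarrow> smat" where
  "sdiag H = (\<lambda>i j. if i = j then H i else 0)"

definition stranspose :: "smat \<Rightarrow> smat" where
  "stranspose A = (\<lambda>i j. A j i)"

definition lower_times :: "smat \<Rightarrow> smat \<Rightarrow> smat" where
  "lower_times A B = (\<lambda>i j. \<Sum>k\<le>i. A i k * B k j)"

definition lower_times_vec :: "smat \<Rightarrow> (nat \<Rightarrow> real poly) \<Rightarrow> nat \<Rightarrow> real poly" where
  "lower_times_vec A V = (\<lambda>i. \<Sum>k\<le>i. smult (A i k) (V k))"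

definition lower_inverse_of :: "smat \<Rightarrow> smat \<Rightarrow> bool" where
  "lower_inverse_of T S \<longleftrightarrow> lower_unitriangular T \<and>
     lower_times T S = sdiag (\<lambda>_. 1) \<and> lower_times S T = sdiag (\<lambda>_. 1)"

text \<open>In the next definition \<open>T\<close> and \<open>Tt\<close> are the inverses of \<open>S\<close> and \<open>St\<close>, so the last equation
  reads: \<open>g\<close> is the product of the inverse of \<open>S\<close>, of \<open>H\<close>, and of the inverse transpose of \<open>St\<close>.\<close>

definition gauss_borel :: "smat \<Rightarrow> smat \<Rightarrow> (nat \<Rightarrow> real) \<Rightarrow> smat \<Rightarrow> bool" where
  "gauss_borel g S H St \<longleftrightarrow>
     lower_unitriangular S \<and> lower_unitriangular St \<and> (\<forall>n. H n \<noteq> 0) \<and>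
     (\<exists>T Tt. lower_inverse_of T S \<and> lower_inverse_of Tt St \<and>
        g = lower_times T (lower_times (sdiag H) (stranspose Tt)))"

definition X :: "nat \<Rightarrow> real poly" where
  "X n = monom 1 n"

definition X1 :: "nat \<Rightarrow> real poly" where
  "X1 n = (if even n then monom 1 (n div 2) else 0)"

definition X2 :: "nat \<Rightarrow> real poly" where
  "X2 n = (if odd n then monom 1 (n div 2) else 0)"

definition moment_matrix :: "real measure \<Rightarrow> (real \<Rightarrow> real) \<Rightarrow> (real \<Rightarrow> real) \<Rightarrow> smat" where
  "moment_matrix M w1 w2 = (\<lambda>i j. \<integral>x. poly (X i) x * (poly (X1 j) x * w1 x + poly (X2 j) x * w2 x) \<partial>M)"

definition perfect :: "real measure \<Rightarrow> (real \<Rightarrow> real) \<Rightarrow> (real \<Rightarrow> real) \<Rightarrow> bool" where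
  "perfect M w1 w2 \<longleftrightarrow> (\<exists>S H St. gauss_borel (moment_matrix M w1 w2) S H St)"

text \<open>The factorization is unique if it exists, see \<open>gauss_borel_factors_eq\<close> below.\<close>

definition gauss_borel_factors :: "smat \<Rightarrow> smat \<times> (nat \<Rightarrow> real) \<times> smat" where
  "gauss_borel_factors g = (THE (S, H, St). gauss_borel g S H St)"

definition type_II :: "real measure \<Rightarrow> (real \<Rightarrow> real) \<Rightarrow> (real \<Rightarrow> real) \<Rightarrow> nat \<Rightarrow> real poly" where
  "type_II M w1 w2 =
     (case gauss_borel_factors (moment_matrix M w1 w2) of (S, H, St) \<Rightarrow> lower_times_vec S X)"

definition type_I :: "(nat \<Rightarrow> real poly) \<Rightarrow>
    real measure \<Rightarrow> (real \<Rightarrow> real) \<Rightarrow> (real \<Rightarrow> real) \<Rightarrow> nat \<Rightarrow> real poly" where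
  "type_I Xa M w1 w2 =
     (case gauss_borel_factors (moment_matrix M w1 w2) of
        (S, H, St) \<Rightarrow> (\<lambda>n. smult (inverse (H n)) (lower_times_vec St Xa n)))"

abbreviation "type_I_1 \<equiv> type_I X1"
abbreviation "type_I_2 \<equiv> type_I X2"

definition linear_form ::
    "real measure \<Rightarrow> (real \<Rightarrow> real) \<Rightarrow> (real \<Rightarrow> real) \<Rightarrow> nat \<Rightarrow> real \<Rightarrow> real" where
  "linear_form M w1 w2 n x =
     w1 x * poly (type_I_1 M w1 w2 n) x + w2 x * poly (type_I_2 M w1 w2 n) x"

lemma lower_times_sdiag_left: "lower_times (sdiag H) B = (\<lambda>i j. H i * B i j)"
  unfolding lower_times_def sdiag_def
  by (auto simp: fun_eq_iff if_distrib[where f = "\<lambda>x. x * _"] cong: if_cong)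

lemma lower_times_one_right:
  assumes "lower_unitriangular A"
  shows "lower_times A (sdiag (\<lambda>_. 1)) = A"
proof (intro ext)
  fix i j
  show "lower_times A (sdiag (\<lambda>_. 1)) i j = A i j"
    using assms unfolding lower_times_def sdiag_def lower_unitriangular_def
    by (auto simp: if_distrib[where f = "\<lambda>x. _ * x"] cong: if_cong)
qed

lemma lower_times_assoc:
  assumes "lower_unitriangular B"
  shows "lower_times A (lower_times B C) = lower_times (lower_times A B) C"
proof (intro ext)
  fix i j
  have row: "(\<Sum>l\<le>k. B k l * C l j) = (\<Sum>l\<le>i. B k l * C l j)" if "k \<le> i" for k
    using that assms unfolding lower_unitriangular_def by (intro sum.mono_neutral_left) auto
  have "lower_times A (lower_times B C) i j = (\<Sum>k\<le>i. \<Sum>l\<le>i. A i k * B k l * C l j)"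
    unfolding lower_times_def by (intro sum.cong) (auto simp: row sum_distrib_left mult.assoc)
  also have "\<dots> = lower_times (lower_times A B) C i j"
    unfolding lower_times_def by (subst sum.swap) (simp add: sum_distrib_right)
  finally show "lower_times A (lower_times B C) i j = lower_times (lower_times A B) C i j" .
qed

lemma lower_inverse_of_unique:
  assumes "lower_inverse_of T S" "lower_inverse_of T S'"
    and "lower_unitriangular S" "lower_unitriangular S'"
  shows "S = S'"
proof -
  have "S = lower_times S (lower_times T S')"
    using assms by (simp add: lower_inverse_of_def lower_times_one_right)
  also have "\<dots> = lower_times (lower_times S T) S'"
    using assms by (intro lower_times_assoc) (simp add: lower_inverse_of_def)
  also have "\<dots> = lower_times (sdiag (\<lambda>_. 1)) S'"
    using assms by (simp add: lower_inverse_of_def)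
  also have "\<dots> = S'"
    by (simp add: lower_times_sdiag_left)
  finally show ?thesis .
qed

lemma LDU_unique:
  fixes L U L' U' :: smat
  assumes "lower_unitriangular L" "lower_unitriangular L'"
    and "lower_unitriangular U" "lower_unitriangular U'"
    and nz: "\<And>n. D n \<noteq> 0"
    and eq: "\<And>i j. (\<Sum>k\<le>i. L i k * (D k * U j k)) = (\<Sum>k\<le>i. L' i k * (D' k * U' j k))"
  shows "(\<forall>i. L i n = L' i n) \<and> D n = D' n \<and> (\<forall>i. U i n = U' i n)"
proof (induction n rule: less_induct)
  case (less n)
  have col: "(\<Sum>k\<le>i. A i k * (E k * B j k)) = (\<Sum>k<n. A i k * (E k * B j k)) + A i n * (E n * B j n)"
    if "lower_unitriangular A" "lower_unitriangular B" "min i j = n" for A B :: smat and E i j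
  proof -
    have "(\<Sum>k\<le>i. A i k * (E k * B j k)) = (\<Sum>k\<le>n. A i k * (E k * B j k))"
      using that unfolding lower_unitriangular_def
      by (intro sum.mono_neutral_right) (auto simp: min_def split: if_splits)
    then show ?thesis by (simp add: lessThan_Suc_atMost[symmetric])
  qed
  have "(\<Sum>k<n. L i k * (D k * U j k)) = (\<Sum>k<n. L' i k * (D' k * U' j k))" for i j
    using less.IH by (intro sum.cong) auto
  then have key: "L i n * (D n * U j n) = L' i n * (D' n * U' j n)" if "min i j = n" for i j
    using eq[of i j] col[of L U i j D] col[of L' U' i j D'] that assms by simp
  have one: "L n n = 1" "L' n n = 1" "U n n = 1" "U' n n = 1"
    using assms by (auto simp: lower_unitriangular_def)
  have D: "D n = D' n" using key[of n n] one by simp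
  have "L i n = L' i n" for i
  proof (cases "n \<le> i")
    case True
    then show ?thesis using key[of i n] one D nz[of n] by simp
  qed (use assms in \<open>auto simp: lower_unitriangular_def\<close>)
  moreover have "U i n = U' i n" for i
  proof (cases "n \<le> i")
    case True
    then show ?thesis using key[of n i] one D nz[of n] by simp
  qed (use assms in \<open>auto simp: lower_unitriangular_def\<close>)
  ultimately show ?case using D by blast
qed

lemma gauss_borel_unique:
  assumes "gauss_borel g S H St" "gauss_borel g S' H' St'"
  shows "S = S' \<and> H = H' \<and> St = St'"
proof -
  from assms(1) obtain T Tt where 1: "lower_inverse_of T S" "lower_inverse_of Tt St"
    "g = lower_times T (lower_times (sdiag H) (stranspose Tt))" "lower_unitriangular S"
    "lower_unitriangular St" "\<And>n. H n \<noteq> 0"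
    unfolding gauss_borel_def by blast
  from assms(2) obtain T' Tt' where 2: "lower_inverse_of T' S'" "lower_inverse_of Tt' St'"
    "g = lower_times T' (lower_times (sdiag H') (stranspose Tt'))" "lower_unitriangular S'"
    "lower_unitriangular St'"
    unfolding gauss_borel_def by blast
  have g: "(\<Sum>k\<le>i. T i k * (H k * Tt j k)) = (\<Sum>k\<le>i. T' i k * (H' k * Tt' j k))" for i j
  proof -
    have "(\<Sum>k\<le>i. T i k * (H k * Tt j k)) = g i j"
      unfolding 1(3) by (simp add: lower_times_sdiag_left) (simp add: lower_times_def stranspose_def)
    also have "\<dots> = (\<Sum>k\<le>i. T' i k * (H' k * Tt' j k))"
      unfolding 2(3) by (simp add: lower_times_sdiag_left) (simp add: lower_times_def stranspose_def)
    finally show ?thesis .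
  qed
  have lu: "lower_unitriangular T" "lower_unitriangular T'"
    "lower_unitriangular Tt" "lower_unitriangular Tt'"
    using 1 2 by (simp_all add: lower_inverse_of_def)
  have "(\<forall>i. T i n = T' i n) \<and> H n = H' n \<and> (\<forall>i. Tt i n = Tt' i n)" for n
    using LDU_unique[OF lu, of H H' n] g 1(6) by blast
  then have "T = T'" "H = H'" "Tt = Tt'" by (auto simp: fun_eq_iff)
  then show ?thesis
    using lower_inverse_of_unique 1 2 by blast
qed

lemma gauss_borel_factors_eq:
  assumes "gauss_borel g S H St"
  shows "gauss_borel_factors g = (S, H, St)"
  unfolding gauss_borel_factors_def
  by (rule the_equality) (use assms gauss_borel_unique in \<open>auto split: prod.splits\<close>)

lemma moment_matrix_cong_AE:
  assumes "is_weight M w1" "is_weight M w2" "is_weight M v1" "is_weight M v2"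
    and "AE x in M. w1 x = v1 x" "AE x in M. w2 x = v2 x"
  shows "moment_matrix M w1 w2 = moment_matrix M v1 v2"
proof (intro ext)
  fix i j
  have meas: "w1 \<in> borel_measurable M" "w2 \<in> borel_measurable M"
    "v1 \<in> borel_measurable M" "v2 \<in> borel_measurable M"
    using assms(1-4)[unfolded is_weight_def, THEN spec[of _ 0]] by auto
  have pow: "(\<lambda>x. x ^ k * w x) \<in> borel_measurable M" if "is_weight M w" for k w
    using that unfolding is_weight_def by auto
  have split: "(\<lambda>x. poly (X i) x * (poly (X1 j) x * w x + poly (X2 j) x * v x))
     = (if even j then (\<lambda>x. x ^ (i + j div 2) * w x) else (\<lambda>x. x ^ (i + j div 2) * v x))" for w v
    by (auto simp: X_def X1_def X2_def poly_monom power_add mult.assoc)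
  show "moment_matrix M w1 w2 i j = moment_matrix M v1 v2 i j"
    unfolding moment_matrix_def
  proof (rule integral_cong_AE)
    show "AE x in M. poly (X i) x * (poly (X1 j) x * w1 x + poly (X2 j) x * w2 x) =
        poly (X i) x * (poly (X1 j) x * v1 x + poly (X2 j) x * v2 x)"
      using assms(5,6) by eventually_elim simp
  qed (use assms pow in \<open>simp_all add: split\<close>)
qed

end

theory Submission
  imports Defs
begin

text \<open>The monic polynomials \<open>B\<^sup>(\<^sup>n\<^sup>)\<close> determine the factor \<open>S\<close>, so it is common to both systems. Since
  \<open>S g\<close> is upper triangular, its columns 0 and 1 live in dimensions one and two. Hence the
  normalization forces the two first columns of moments to agree, and the second columns of the
  two systems together with the first one are linearly dependent. On a compact set the moments
  determine an integrable weight, so these relations hold between the weights themselves.\<close>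

section \<open>Determinacy of compactly supported weights\<close>

lemma integral_times_polynomial_eq_0:
  fixes f :: "real \<Rightarrow> real"
  assumes w: "is_weight M f" and zero: "\<And>k. (\<integral>x. x ^ k * f x \<partial>M) = 0"
    and p: "real_polynomial_function p"
  shows "integrable M (\<lambda>x. p x * f x)" "(\<integral>x. p x * f x \<partial>M) = 0"
proof -
  obtain a n where p: "p = (\<lambda>x. \<Sum>i\<le>n. a i * x ^ i)"
    using p real_polynomial_function_iff_sum by blast
  have eq: "(\<lambda>x. p x * f x) = (\<lambda>x. \<Sum>i\<le>n. a i * (x ^ i * f x))"
    by (simp add: p sum_distrib_right mult.assoc)
  have int: "integrable M (\<lambda>x. a i * (x ^ i * f x))" for i
    using w by (simp add: is_weight_def)
  then show "integrable M (\<lambda>x. p x * f x)"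
    unfolding eq by (intro Bochner_Integration.integrable_sum)
  show "(\<integral>x. p x * f x \<partial>M) = 0"
    unfolding eq using int zero by (subst Bochner_Integration.integral_sum) simp_all
qed

text \<open>By Weierstrass, \<open>h\<close> is uniformly close to a polynomial on \<open>K\<close>,
  and the polynomial integrates to 0 against \<open>f\<close>. The error is controlled by the
  integral of the absolute value of \<open>f\<close>, so \<open>M\<close> itself may be
  infinite.\<close>

lemma integral_times_continuous_eq_0:
  fixes f h :: "real \<Rightarrow> real"
  assumes sp: "space M \<subseteq> K" and K: "compact K"
    and w: "is_weight M f" and zero: "\<And>k. (\<integral>x. x ^ k * f x \<partial>M) = 0"
    and h: "continuous_on K h" and int: "integrable M (\<lambda>x. h x * f x)"
  shows "(\<integral>x. h x * f x \<partial>M) = 0"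
proof (rule ccontr)
  let ?I = "\<integral>x. h x * f x \<partial>M" and ?N = "\<integral>x. \<bar>f x\<bar> \<partial>M"
  assume nz: "?I \<noteq> 0"
  have f: "integrable M f" using w[unfolded is_weight_def, rule_format, of 0] by simp
  have "?N \<ge> 0" by simp
  then have N: "?N + 1 > 0" by linarith
  \<comment> \<open>Small enough that \<open>e * ?N\<close> stays below the absolute value of
    \<open>?I\<close>; the summand 1 avoids division by zero when \<open>?N = 0\<close>.\<close>
  define e where "e = \<bar>?I\<bar> / (?N + 1)"
  have e: "e > 0" using nz N by (simp add: e_def)
  obtain p where p: "real_polynomial_function p" "\<And>x. x \<in> K \<Longrightarrow> \<bar>h x - p x\<bar> < e"
    using Stone_Weierstrass_real_polynomial_function[OF K h e] by blast
  note pf = integral_times_polynomial_eq_0[OF w zero p(1)]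
  have "\<bar>?I\<bar> = \<bar>\<integral>x. h x * f x - p x * f x \<partial>M\<bar>"
    using pf int by simp
  also have "\<dots> \<le> (\<integral>x. \<bar>h x * f x - p x * f x\<bar> \<partial>M)"
    by (rule integral_abs_bound)
  also have "\<dots> \<le> (\<integral>x. e * \<bar>f x\<bar> \<partial>M)"
  proof (rule integral_mono)
    show "\<bar>h x * f x - p x * f x\<bar> \<le> e * \<bar>f x\<bar>" if "x \<in> space M" for x
      using mult_right_mono[OF less_imp_le[OF p(2)[of x]], of "\<bar>f x\<bar>"] that sp
      by (auto simp: left_diff_distrib[symmetric] abs_mult)
  qed (use f pf int in auto)
  also have "\<dots> = e * ?N" by simp
  also have "\<dots> < e * (?N + 1)" using e by simp
  also have "\<dots> = \<bar>?I\<bar>" using N unfolding e_def by simp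
  finally show False by simp
qed

text \<open>The half-line \<open>{..a}\<close> is a pointwise limit of piecewise linear continuous functions.\<close>

lemma integral_atMost_eq_0:
  fixes f :: "real \<Rightarrow> real"
  assumes sp: "space M \<subseteq> K" and K: "compact K" and M: "(\<lambda>x. x) \<in> borel_measurable M"
    and w: "is_weight M f" and zero: "\<And>k. (\<integral>x. x ^ k * f x \<partial>M) = 0"
  shows "(\<integral>x. indicator {..a} x * f x \<partial>M) = 0"
proof -
  \<comment> \<open>A ramp: 1 up to \<open>a\<close>, then, for positive \<open>n\<close>, linear
    down to 0 at \<open>a + 1 / n\<close>. For \<open>n = 0\<close> it is constantly 1, which does
    not affect the limit.\<close>
  define h where "h n x = max 0 (min 1 (1 - real n * (x - a)))" for n x
  have f: "integrable M f" using w[unfolded is_weight_def, rule_format, of 0] by simp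
  have [measurable]: "f \<in> borel_measurable M" using f by auto
  note [measurable] = M
  have hc: "continuous_on K (h n)" for n
    unfolding h_def by (intro continuous_intros)
  have hm [measurable]: "h n \<in> borel_measurable M" for n
    unfolding h_def by measurable
  have [measurable]: "(indicator {..a} :: real \<Rightarrow> real) \<in> borel_measurable M"
    using measurable_compose[OF M, of "indicator {..a} :: real \<Rightarrow> real" borel] by simp
  have h01: "0 \<le> h n x" "h n x \<le> 1" for n x by (auto simp: h_def)
  have b: "\<bar>h n x * f x\<bar> \<le> \<bar>f x\<bar>" for n x
    using h01[of n x] by (auto simp: abs_mult intro!: mult_left_le_one_le)
  have hf: "integrable M (\<lambda>x. h n x * f x)" for n
    by (rule Bochner_Integration.integrable_bound[OF f]) (use b in auto)
  have "(\<lambda>n. h n x) \<longlonglongrightarrow> indicator {..a} x" for x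
  proof (cases "x \<le> a")
    case True
    then have "h n x = 1" for n
      by (auto simp: h_def min_def max_def mult_le_0_iff)
    then show ?thesis using True by simp
  next
    case False
    obtain m where m: "1 / (x - a) < real m" using reals_Archimedean2 by blast
    have "h n x = 0" if "n \<ge> m" for n
    proof -
      have "1 / (x - a) < real n" using m that by linarith
      then have "1 < real n * (x - a)" using False by (simp add: pos_divide_less_eq)
      then show ?thesis by (simp add: h_def)
    qed
    then have "\<forall>\<^sub>F n in sequentially. h n x = 0" by (auto simp: eventually_sequentially)
    then show ?thesis using False by (simp add: tendsto_eventually)
  qed
  then have lim: "(\<lambda>n. \<integral>x. h n x * f x \<partial>M) \<longlonglongrightarrow> (\<integral>x. indicator {..a} x * f x \<partial>M)"
    by (intro integral_dominated_convergence[where w = "\<lambda>x. \<bar>f x\<bar>"])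
      (use f b in \<open>auto intro!: tendsto_mult\<close>)
  have "(\<integral>x. h n x * f x \<partial>M) = 0" for n
    by (rule integral_times_continuous_eq_0[OF sp K w zero hc hf])
  then show ?thesis using LIMSEQ_unique[OF lim] by simp
qed

text \<open>A Dynkin argument: the half-lines form an intersection-stable generator of the Borel
  sets, and the sets over which \<open>f\<close> integrates to 0 are closed under complement (by
  \<open>total\<close>) and countable disjoint union. Measurability of the identity makes indicators
  of Borel sets of the line measurable for \<open>M\<close>.\<close>

lemma set_integral_borel_eq_0:
  fixes f :: "real \<Rightarrow> real"
  assumes f: "integrable M f" and M: "(\<lambda>x. x) \<in> borel_measurable M"
    and total: "(\<integral>x. f x \<partial>M) = 0"
    and atMost: "\<And>a. (\<integral>x. indicator {..a} x * f x \<partial>M) = 0"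
    and A: "A \<in> sets borel"
  shows "(\<integral>x. indicator A x * f x \<partial>M) = 0"
proof -
  have int: "integrable M (\<lambda>x. indicator B x * f x)" if "B \<in> sets borel" for B
  proof (rule Bochner_Integration.integrable_bound[OF f])
    have "(indicator B :: real \<Rightarrow> real) \<in> borel_measurable M"
      using measurable_compose[OF M, of "indicator B :: real \<Rightarrow> real" borel] that by simp
    then show "(\<lambda>x. indicator B x * f x) \<in> borel_measurable M" using f by measurable
  qed (auto simp: indicator_def)
  have borel: "sets (borel :: real measure) = sigma_sets UNIV (range atMost)"
    by (subst borel_eq_atMost) simp
  have "Int_stable (range (atMost :: real \<Rightarrow> real set))"
    by (auto simp: Int_stable_def image_iff)
  moreover have "range (atMost :: real \<Rightarrow> real set) \<subseteq> Pow UNIV" by simp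
  moreover have "A \<in> sigma_sets UNIV (range (atMost :: real \<Rightarrow> real set))"
    using A borel by simp
  ultimately show ?thesis
  proof (induction rule: sigma_sets_induct_disjoint)
    case (basic B)
    then show ?case using atMost by auto
  next
    case (compl B)
    have "(\<lambda>x. indicator (UNIV - B) x * f x) = (\<lambda>x. f x - indicator B x * f x)"
      by (auto simp: indicator_def fun_eq_iff)
    then show ?case using compl total f int[of B] borel by simp
  next
    case (union B)
    have B: "B n \<in> sets borel" for n using union borel by blast
    \<comment> \<open>Dominated convergence along the finite partial unions, where disjointness
      splits the integral into a finite sum of zeros.\<close>
    have "(\<lambda>n. \<integral>x. indicator (\<Union>i<n. B i) x * f x \<partial>M) \<longlonglongrightarrow>
        (\<integral>x. indicator (\<Union>n. B n) x * f x \<partial>M)"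
    proof (rule integral_dominated_convergence[where w = "\<lambda>x. \<bar>f x\<bar>"])
      have "(\<lambda>n. indicator (\<Union>i<n. B i) x * f x) \<longlonglongrightarrow> indicator (\<Union>n. B n) x * f x" for x
        by (intro tendsto_mult LIMSEQ_indicator_UN tendsto_const)
      then show "AE x in M. (\<lambda>n. indicator (\<Union>i<n. B i) x * f x) \<longlonglongrightarrow> indicator (\<Union>n. B n) x * f x"
        by simp
      show "(\<lambda>x. indicator (\<Union>n. B n) x * f x) \<in> borel_measurable M"
        "(\<lambda>x. indicator (\<Union>i<n. B i) x * f x) \<in> borel_measurable M" for n
        using B by (auto intro!: borel_measurable_integrable int)
    qed (use f in \<open>auto simp: indicator_def\<close>)
    moreover have "(\<integral>x. indicator (\<Union>i<n. B i) x * f x \<partial>M) = 0" for n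
    proof -
      have "indicator (\<Union>i<n. B i) x = (\<Sum>i<n. indicator (B i) x :: real)" for x
        by (rule indicator_UN_disjoint) (use union(1) in \<open>auto simp: disjoint_family_on_def\<close>)
      then have "(\<integral>x. indicator (\<Union>i<n. B i) x * f x \<partial>M) = (\<integral>x. (\<Sum>i<n. indicator (B i) x * f x) \<partial>M)"
        by (simp only: sum_distrib_right)
      also have "\<dots> = (\<Sum>i<n. \<integral>x. indicator (B i) x * f x \<partial>M)"
        by (rule Bochner_Integration.integral_sum) (rule int[OF B])
      finally show ?thesis using union(3) by simp
    qed
    ultimately show ?case by (simp add: LIMSEQ_const_iff)
  qed simp
qed

text \<open>The set where \<open>f\<close> is positive is the trace on \<open>K\<close> of a Borel
  set, so the positive part of \<open>f\<close> has integral 0. Since \<open>f\<close> also has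
  integral 0, so does its absolute value.\<close>

lemma AE_eq_0_if_moments_eq_0:
  fixes f :: "real \<Rightarrow> real"
  assumes sets: "sets M = sets (restrict_space borel K)" and K: "compact K"
    and w: "is_weight M f" and zero: "\<And>k. (\<integral>x. x ^ k * f x \<partial>M) = 0"
  shows "AE x in M. f x = 0"
proof -
  have sp: "space M = K" using sets_eq_imp_space_eq[OF sets] by (simp add: space_restrict_space)
  have id: "(\<lambda>x. x) \<in> borel_measurable M"
    unfolding measurable_cong_sets[OF sets refl] by (rule measurable_restrict_space1) simp
  have f: "integrable M f" using w[unfolded is_weight_def, rule_format, of 0] by simp
  have total: "(\<integral>x. f x \<partial>M) = 0" using zero[of 0] by simp
  let ?P = "{x \<in> space M. 0 < f x}"
  have "?P \<in> sets M" using f by (intro borel_measurable_less) auto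
  then obtain B where B: "B \<in> sets borel" "?P = K \<inter> B"
    by (auto simp: sets sets_restrict_space)
  have "max 0 (f x) = indicator B x * f x" if "x \<in> space M" for x
  proof -
    have "0 < f x \<longleftrightarrow> x \<in> B" using that B(2) sp by blast
    then show ?thesis by (cases "x \<in> B") simp_all
  qed
  then have "(\<integral>x. max 0 (f x) \<partial>M) = (\<integral>x. indicator B x * f x \<partial>M)"
    by (intro Bochner_Integration.integral_cong refl)
  also have "\<dots> = 0"
    by (rule set_integral_borel_eq_0[OF f id total integral_atMost_eq_0[OF _ K id w zero] B(1)])
      (simp add: sp)
  finally have pos: "(\<integral>x. max 0 (f x) \<partial>M) = 0" .
  have absf: "\<bar>f x\<bar> = 2 * max 0 (f x) - f x" for x by auto
  have "(\<integral>x. \<bar>f x\<bar> \<partial>M) = 0"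
    unfolding absf using f pos total by simp
  then show ?thesis
    using integral_nonneg_eq_0_iff_AE[of M "\<lambda>x. \<bar>f x\<bar>"] f by simp
qed

section \<open>Consequences of the Gauss--Borel factorization\<close>

text \<open>Multiplying by \<open>S\<close> cancels the left factor of \<open>g\<close> and leaves
  the upper triangular product of \<open>H\<close> and the transpose of \<open>Tt\<close>.\<close>

lemma gauss_borel_lower_times:
  assumes "gauss_borel g S H St"
  obtains Tt where "lower_inverse_of Tt St" "\<And>i j. lower_times S g i j = H i * Tt j i"
proof -
  obtain T Tt where T: "lower_inverse_of T S" "lower_inverse_of Tt St"
    "g = lower_times T (lower_times (sdiag H) (stranspose Tt))"
    using assms unfolding gauss_borel_def by blast
  have "lower_times S g = lower_times (lower_times S T) (lower_times (sdiag H) (stranspose Tt))"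
    unfolding T(3) using T(1) by (intro lower_times_assoc) (simp add: lower_inverse_of_def)
  also have "\<dots> = (\<lambda>i j. H i * Tt j i)"
    using T(1) by (simp add: lower_inverse_of_def lower_times_sdiag_left stranspose_def)
  finally show ?thesis using that T(2) by (simp add: fun_eq_iff)
qed

lemma gauss_borel_upper:
  assumes "gauss_borel g S H St"
  shows "lower_times S g n n = H n" "j < i \<Longrightarrow> lower_times S g i j = 0"
  using gauss_borel_lower_times[OF assms]
  unfolding lower_inverse_of_def lower_unitriangular_def by (metis mult.right_neutral mult_zero_right)+

text \<open>Forward substitution: row \<open>i\<close> involves only the entries of \<open>u\<close>
  up to \<open>i\<close>, the last one with coefficient 1. Relations between columns of
  \<open>S g\<close> thus descend to columns of \<open>g\<close>.\<close>

lemma lower_unitriangular_cancel: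
  assumes "lower_unitriangular S" and "\<And>i. (\<Sum>k\<le>i. S i k * u k) = 0"
  shows "u i = 0"
proof (induction i rule: less_induct)
  case (less i)
  have "(\<Sum>k\<le>i. S i k * u k) = (\<Sum>k<i. S i k * u k) + S i i * u i"
    by (simp add: lessThan_Suc_atMost[symmetric])
  then show ?case using less assms by (simp add: lower_unitriangular_def)
qed

lemma smult_sum_right: "smult c (sum f A) = (\<Sum>i\<in>A. smult c (f i))"
  by (induction A rule: infinite_finite_induct) (simp_all add: smult_add_right)

text \<open>This lets \<open>S\<close> be read off from the type II polynomials.\<close>

lemma coeff_lower_times_vec_X:
  assumes "lower_unitriangular S"
  shows "coeff (lower_times_vec S X n) k = S n k"
proof -
  have "coeff (lower_times_vec S X n) k = (\<Sum>i\<le>n. if i = k then S n i else 0)"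
    unfolding lower_times_vec_def X_def coeff_sum by (intro sum.cong) auto
  also have "\<dots> = S n k"
    using assms by (auto simp: lower_unitriangular_def)
  finally show ?thesis .
qed

lemma type_II_eq:
  assumes "gauss_borel (moment_matrix M w1 w2) S H St"
  shows "type_II M w1 w2 = lower_times_vec S X"
  by (simp add: type_II_def gauss_borel_factors_eq[OF assms])

text \<open>The product \<open>S g\<close> is \<open>H\<close> times the inverse transpose of \<open>St\<close>, so \<open>A = H\<^sup>-\<^sup>1 St Xa\<close> can be
  restated without the other two factors: the transpose of \<open>S g\<close> maps \<open>A\<close> to \<open>Xa\<close>.\<close>

lemma type_I_iff:
  assumes gb: "gauss_borel (moment_matrix M w1 w2) S H St"
  shows "type_I Xa M w1 w2 = A \<longleftrightarrow>
    (\<forall>j. (\<Sum>i\<le>j. smult (lower_times S (moment_matrix M w1 w2) i j) (A i)) = Xa j)"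
proof -
  obtain Tt where Tt: "lower_inverse_of Tt St"
    "\<And>i j. lower_times S (moment_matrix M w1 w2) i j = H i * Tt j i"
    using gauss_borel_lower_times[OF gb] by blast
  have nz: "H n \<noteq> 0" for n using gb by (simp add: gauss_borel_def)
  have I: "type_I Xa M w1 w2 n = smult (inverse (H n)) (lower_times_vec St Xa n)" for n
    by (simp add: type_I_def gauss_borel_factors_eq[OF gb])
  have vec_assoc: "lower_times_vec P (lower_times_vec Q V) = V"
    if "lower_unitriangular Q" "lower_times P Q = sdiag (\<lambda>_. 1)" for P Q V
  proof
    fix i
    \<comment> \<open>Padding the rows of \<open>Q\<close> with zeros up to the common bound
      \<open>i\<close> allows the two sums to be interchanged.\<close>
    have row: "(\<Sum>l\<le>k. smult (Q k l) (V l)) = (\<Sum>l\<le>i. smult (Q k l) (V l))" if "k \<le> i" for k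
      using that \<open>lower_unitriangular Q\<close> unfolding lower_unitriangular_def
      by (intro sum.mono_neutral_left) auto
    have "lower_times_vec P (lower_times_vec Q V) i = (\<Sum>k\<le>i. \<Sum>l\<le>i. smult (P i k * Q k l) (V l))"
      unfolding lower_times_vec_def by (intro sum.cong) (simp_all add: row smult_sum_right)
    also have "\<dots> = (\<Sum>l\<le>i. smult (lower_times P Q i l) (V l))"
      unfolding lower_times_def by (subst sum.swap) (simp add: smult_sum)
    also have "\<dots> = (\<Sum>l\<le>i. if l = i then V l else 0)"
      unfolding that(2) sdiag_def by (intro sum.cong) auto
    finally show "lower_times_vec P (lower_times_vec Q V) i = V i" by simp
  qed
  have inv: "lower_times_vec Tt (lower_times_vec St V) = V"
    "lower_times_vec St (lower_times_vec Tt V) = V" for V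
    using Tt(1) gb by (auto intro!: vec_assoc simp: lower_inverse_of_def gauss_borel_def)
  have "smult (inverse (H n)) P = Q \<longleftrightarrow> P = smult (H n) Q" for n P Q
    using nz[of n] by auto
  then have "type_I Xa M w1 w2 = A \<longleftrightarrow> lower_times_vec St Xa = (\<lambda>n. smult (H n) (A n))"
    by (simp add: fun_eq_iff I)
  also have "\<dots> \<longleftrightarrow> lower_times_vec Tt (\<lambda>n. smult (H n) (A n)) = Xa"
    using inv by metis
  also have "\<dots> \<longleftrightarrow> (\<forall>j. (\<Sum>i\<le>j. smult (H i * Tt j i) (A i)) = Xa j)"
    by (simp add: fun_eq_iff lower_times_vec_def mult.commute)
  finally show ?thesis by (simp add: Tt(2))
qed

lemma moment_matrix_eq:
  "moment_matrix M w1 w2 i j = (\<integral>x. x ^ (i + j div 2) * (if even j then w1 x else w2 x) \<partial>M)"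
  unfolding moment_matrix_def
  by (rule Bochner_Integration.integral_cong)
    (auto simp: X_def X1_def X2_def poly_monom power_add mult.assoc)

text \<open>Passing from \<open>w2\<close> to \<open>v\<close> keeps the even columns of the moment matrix and adds multiples of them
  to the odd ones.\<close>

lemma type_I_change_second_weight:
  assumes w: "is_weight M w1" "is_weight M w2" "is_weight M v"
    and v: "AE x in M. v x = a * w1 x + b * w2 x" and b: "b \<noteq> 0"
    and gb: "gauss_borel (moment_matrix M w1 w2) S H St"
    and gb': "gauss_borel (moment_matrix M w1 v) S H' St'"
  shows "type_I_1 M w1 v m = type_I_1 M w1 w2 m - smult (a / b) (type_I_2 M w1 w2 m)"
    and "type_I_2 M w1 v m = smult (1 / b) (type_I_2 M w1 w2 m)"
proof -
  let ?g = "moment_matrix M w1 w2" and ?h = "moment_matrix M w1 v"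
  let ?C = "lower_times S ?g" and ?D = "lower_times S ?h"
  have int: "integrable M (\<lambda>x. x ^ k * w1 x)" "integrable M (\<lambda>x. x ^ k * w2 x)"
    "integrable M (\<lambda>x. x ^ k * v x)" for k
    using w by (auto simp: is_weight_def)
  have odd_moment: "(\<integral>x. x ^ k * v x \<partial>M) = a * (\<integral>x. x ^ k * w1 x \<partial>M) + b * (\<integral>x. x ^ k * w2 x \<partial>M)" for k
  proof -
    have "(\<integral>x. x ^ k * v x \<partial>M) = (\<integral>x. a * (x ^ k * w1 x) + b * (x ^ k * w2 x) \<partial>M)"
    proof (rule integral_cong_AE)
      show "AE x in M. x ^ k * v x = a * (x ^ k * w1 x) + b * (x ^ k * w2 x)"
        using v by eventually_elim (simp add: algebra_simps)
    qed (use int in \<open>auto intro!: borel_measurable_integrable\<close>)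
    then show ?thesis using int by simp
  qed
  \<comment> \<open>For odd \<open>j\<close>, columns \<open>j - 1\<close> and \<open>j\<close>
    carry the same power of the variable, with \<open>w1\<close> and \<open>w2\<close>
    respectively.\<close>
  have "?h i j = (if even j then ?g i j else a * ?g i (j - 1) + b * ?g i j)" for i j
    using odd_moment by (auto simp: moment_matrix_eq elim!: oddE)
  then have D: "?D i j = (if even j then ?C i j else a * ?C i (j - 1) + b * ?C i j)" for i j
    by (auto simp: lower_times_def sum.distrib sum_distrib_left algebra_simps)
  have rows: "(\<Sum>i\<le>j. smult (?D i j) (A i)) = (if even j then V j else smult a (V (j - 1)) + smult b (V j))"
    if A: "\<And>j. (\<Sum>i\<le>j. smult (?C i j) (A i)) = V j" for A V :: "nat \<Rightarrow> real poly" and j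
  proof (cases "even j")
    case True
    then show ?thesis using A by (simp add: D)
  next
    case False
    have "(\<Sum>i\<le>j. smult (?D i j) (A i)) =
        smult a (\<Sum>i\<le>j. smult (?C i (j - 1)) (A i)) + smult b (\<Sum>i\<le>j. smult (?C i j) (A i))"
      using False by (simp add: D smult_add_left sum.distrib smult_sum_right)
    \<comment> \<open>The extra term \<open>i = j\<close> lies below the diagonal of
      \<open>?C\<close>.\<close>
    also have "(\<Sum>i\<le>j. smult (?C i (j - 1)) (A i)) = (\<Sum>i\<le>j - 1. smult (?C i (j - 1)) (A i))"
      using gauss_borel_upper(2)[OF gb] by (intro sum.mono_neutral_right) auto
    finally show ?thesis using False A by simp
  qed
  define A1 A2 where "A1 = type_I_1 M w1 w2" and "A2 = type_I_2 M w1 w2"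
  have C1: "(\<Sum>i\<le>j. smult (?C i j) (A1 i)) = X1 j" and C2: "(\<Sum>i\<le>j. smult (?C i j) (A2 i)) = X2 j" for j
    using type_I_iff[OF gb] A1_def A2_def by blast+
  have D2: "(\<Sum>i\<le>j. smult (?D i j) (A2 i)) = smult b (X2 j)" for j
    using rows[OF C2] by (auto simp: X2_def)
  \<comment> \<open>For odd \<open>j\<close>, \<open>X1 (j - 1) = X2 j\<close> and
    \<open>X1 j = 0\<close>. The surplus multiple of \<open>X2\<close> is what the correction by
    \<open>A2\<close> removes below.\<close>
  have D1: "(\<Sum>i\<le>j. smult (?D i j) (A1 i)) = X1 j + smult a (X2 j)" for j
    using rows[OF C1] by (auto simp: X1_def X2_def elim!: oddE)
  have sum_smult: "(\<Sum>i\<le>j. smult (?D i j) (smult c (A2 i))) = smult c (smult b (X2 j))" for c j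
    unfolding D2[symmetric] by (simp add: smult_sum_right mult.commute)
  have "type_I_2 M w1 v = (\<lambda>m. smult (1 / b) (A2 m))"
    unfolding type_I_iff[OF gb'] sum_smult using b by simp
  then show "type_I_2 M w1 v m = smult (1 / b) (type_I_2 M w1 w2 m)" by (simp add: A2_def)
  have "type_I_1 M w1 v = (\<lambda>m. A1 m - smult (a / b) (A2 m))"
    unfolding type_I_iff[OF gb'] smult_diff_right sum_subtractf D1 sum_smult using b by simp
  then show "type_I_1 M w1 v m = type_I_1 M w1 w2 m - smult (a / b) (type_I_2 M w1 w2 m)"
    by (simp add: A1_def A2_def)
qed

section \<open>Two perfect systems with common type II polynomials\<close>

theorem proposition6:
  fixes \<Delta> :: "real set" and \<mu> :: "real measure"
    and w1 w2 w1_hat w2_hat :: "real \<Rightarrow> real"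
  assumes measure_on: "sets \<mu> = sets (restrict_space borel \<Delta>)"
    and support: "measure_support \<mu> = \<Delta>" and compact: "compact \<Delta>"
    and weights: "is_weight \<mu> w1" "is_weight \<mu> w2" "is_weight \<mu> w1_hat" "is_weight \<mu> w2_hat"
    and perfect: "perfect \<mu> w1 w2" "perfect \<mu> w1_hat w2_hat"
    and normalized: "(\<integral>x. w1 x \<partial>\<mu>) = 1" "(\<integral>x. w1_hat x \<partial>\<mu>) = 1"
    and same_type_II: "\<forall>n. type_II \<mu> w1 w2 n = type_II \<mu> w1_hat w2_hat n"
  shows "(AE x in \<mu>. w1_hat x = w1 x) \<and>
    (\<exists>\<alpha> \<beta> \<gamma> :: real. \<alpha> \<noteq> 0 \<and> \<beta> \<noteq> 0 \<and>
       (AE x in \<mu>. \<gamma> * w1 x + \<alpha> * w2 x + \<beta> * w2_hat x = 0) \<and>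
       (\<forall>m. type_I_1 \<mu> w1 w2_hat m = type_I_1 \<mu> w1 w2 m - smult (\<gamma> / \<alpha>) (type_I_2 \<mu> w1 w2 m) \<and>
            type_I_2 \<mu> w1 w2_hat m = smult (- (\<beta> / \<alpha>)) (type_I_2 \<mu> w1 w2 m) \<and>
            (AE x in \<mu>. linear_form \<mu> w1 w2_hat m x = linear_form \<mu> w1 w2 m x)))"
proof -
  obtain S H St where gb: "gauss_borel (moment_matrix \<mu> w1 w2) S H St"
    using perfect(1) unfolding perfect_def by blast
  obtain S' H' St' where gb': "gauss_borel (moment_matrix \<mu> w1_hat w2_hat) S' H' St'"
    using perfect(2) unfolding perfect_def by blast
  let ?g = "moment_matrix \<mu> w1 w2" and ?h = "moment_matrix \<mu> w1_hat w2_hat"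
  have lu: "lower_unitriangular S" "lower_unitriangular S'" and nz: "H n \<noteq> 0" "H' n \<noteq> 0" for n
    using gb gb' by (auto simp: gauss_borel_def)
  have "S n k = S' n k" for n k
    using same_type_II type_II_eq[OF gb] type_II_eq[OF gb'] coeff_lower_times_vec_X lu by metis
  then have S': "S' = S" by (simp add: fun_eq_iff)
  note gb' = gb'[unfolded S']
  let ?C = "lower_times S ?g" and ?D = "lower_times S ?h"
  note up = gauss_borel_upper[OF gb] and up' = gauss_borel_upper[OF gb']
  have int: "integrable \<mu> (\<lambda>x. x ^ k * w1 x)" "integrable \<mu> (\<lambda>x. x ^ k * w2 x)"
    "integrable \<mu> (\<lambda>x. x ^ k * w1_hat x)" "integrable \<mu> (\<lambda>x. x ^ k * w2_hat x)" for k
    using weights by (auto simp: is_weight_def)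
  have g: "?g i 0 = (\<integral>x. x ^ i * w1 x \<partial>\<mu>)" "?g i 1 = (\<integral>x. x ^ i * w2 x \<partial>\<mu>)"
    "?h i 0 = (\<integral>x. x ^ i * w1_hat x \<partial>\<mu>)" "?h i 1 = (\<integral>x. x ^ i * w2_hat x \<partial>\<mu>)" for i
    by (simp_all add: moment_matrix_eq)
  have C00: "?C 0 0 = 1" "?D 0 0 = 1"
    using lu g(1,3)[of 0] normalized by (simp_all add: lower_times_def lower_unitriangular_def)
  \<comment> \<open>Both columns vanish below row 0, and the normalization fixes their top
    entries.\<close>
  have col0: "?C i 0 = ?D i 0" for i
    using C00 up(2) up'(2) by (cases i) simp_all
  have "?g i 0 - ?h i 0 = 0" for i
    by (rule lower_unitriangular_cancel[OF lu(1), where u = "\<lambda>i. ?g i 0 - ?h i 0"])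
      (use col0 in \<open>simp add: lower_times_def right_diff_distrib sum_subtractf\<close>)
  then have "AE x in \<mu>. w1_hat x - w1 x = 0"
    using g int
    by (intro AE_eq_0_if_moments_eq_0[OF measure_on compact])
      (simp_all add: is_weight_def right_diff_distrib)
  then have hat1: "AE x in \<mu>. w1_hat x = w1 x" by simp

  \<comment> \<open>After multiplication by \<open>S\<close> the three columns vanish from row 2 on.
    The choice of \<alpha> and \<beta> cancels row 1, where the \<open>w1\<close> column is already
    0, and \<gamma> then cancels row 0 because \<open>?C 0 0 = 1\<close>. Up to sign, \<alpha> and
    \<beta> are the nonzero pivots \<open>H' 1\<close> and \<open>H 1\<close>.\<close>
  define \<alpha> \<beta> \<gamma> where "\<alpha> = ?D 1 1" and "\<beta> = - ?C 1 1" and "\<gamma> = - (\<alpha> * ?C 0 1 + \<beta> * ?D 0 1)"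
  have \<alpha>\<beta>: "\<alpha> \<noteq> 0" "\<beta> \<noteq> 0"
    using up(1) up'(1) nz by (simp_all add: \<alpha>_def \<beta>_def)
  have SC: "\<gamma> * ?C i 0 + \<alpha> * ?C i 1 + \<beta> * ?D i 1 = 0" for i
  proof -
    consider "i = 0" | "i = 1" | "i > 1" by linarith
    then show ?thesis
    proof cases
      case 1
      then show ?thesis using C00 by (simp add: \<gamma>_def)
    next
      case 2
      then show ?thesis using up(2)[of 0 1] by (simp add: \<alpha>_def \<beta>_def)
    next
      case 3
      then show ?thesis using up(2) up'(2) by simp
    qed
  qed
  have "\<gamma> * ?g i 0 + \<alpha> * ?g i 1 + \<beta> * ?h i 1 = 0" for i
  proof (rule lower_unitriangular_cancel[OF lu(1), where u = "\<lambda>i. \<gamma> * ?g i 0 + \<alpha> * ?g i 1 + \<beta> * ?h i 1"])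
    fix i
    have "(\<Sum>k\<le>i. S i k * (\<gamma> * ?g k 0 + \<alpha> * ?g k 1 + \<beta> * ?h k 1)) =
        \<gamma> * ?C i 0 + \<alpha> * ?C i 1 + \<beta> * ?D i 1"
      by (simp add: lower_times_def sum.distrib sum_distrib_left algebra_simps)
    then show "(\<Sum>k\<le>i. S i k * (\<gamma> * ?g k 0 + \<alpha> * ?g k 1 + \<beta> * ?h k 1)) = 0"
      using SC by simp
  qed
  then have moments: "\<gamma> * (\<integral>x. x ^ i * w1 x \<partial>\<mu>) + \<alpha> * (\<integral>x. x ^ i * w2 x \<partial>\<mu>) +
      \<beta> * (\<integral>x. x ^ i * w2_hat x \<partial>\<mu>) = 0" for i
    using g by simp
  have distrib: "(\<lambda>x. x ^ k * (\<gamma> * w1 x + \<alpha> * w2 x + \<beta> * w2_hat x)) =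
      (\<lambda>x. \<gamma> * (x ^ k * w1 x) + \<alpha> * (x ^ k * w2 x) + \<beta> * (x ^ k * w2_hat x))" for k
    by (simp add: fun_eq_iff algebra_simps)
  have dep: "AE x in \<mu>. \<gamma> * w1 x + \<alpha> * w2 x + \<beta> * w2_hat x = 0"
    using moments int
    by (intro AE_eq_0_if_moments_eq_0[OF measure_on compact]) (simp_all add: is_weight_def distrib)

  define a b where "a = - (\<gamma> / \<beta>)" and "b = - (\<alpha> / \<beta>)"
  have v: "AE x in \<mu>. w2_hat x = a * w1 x + b * w2 x"
    using dep by eventually_elim (use \<alpha>\<beta> in \<open>simp add: a_def b_def field_simps\<close>)
  have ab: "b \<noteq> 0" "a / b = \<gamma> / \<alpha>" "1 / b = - (\<beta> / \<alpha>)"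
    using \<alpha>\<beta> by (simp_all add: a_def b_def)
  \<comment> \<open>The type I polynomials in the claim belong to \<open>w1\<close> and
    \<open>w2_hat\<close>; replacing \<open>w1_hat\<close> by the almost everywhere equal
    \<open>w1\<close> keeps the moment matrix and hence its factorization.\<close>
  have "moment_matrix \<mu> w1 w2_hat = ?h"
    by (rule moment_matrix_cong_AE) (use weights hat1 in auto)
  then have "gauss_borel (moment_matrix \<mu> w1 w2_hat) S H' St'" using gb' by simp
  note I = type_I_change_second_weight[OF weights(1,2,4) v ab(1) gb this, unfolded ab(2,3)]
  have "AE x in \<mu>. linear_form \<mu> w1 w2_hat m x = linear_form \<mu> w1 w2 m x" for m
    using dep
  proof eventually_elim
    case (elim x)
    \<comment> \<open>The difference of the forms is a multiple of the linear relation between the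
      weights, so both agree wherever that relation holds.\<close>
    have "linear_form \<mu> w1 w2_hat m x - linear_form \<mu> w1 w2 m x =
        - (\<gamma> * w1 x + \<alpha> * w2 x + \<beta> * w2_hat x) / \<alpha> * poly (type_I_2 \<mu> w1 w2 m) x"
      using \<alpha>\<beta> by (simp add: linear_form_def I field_simps)
    then show ?case using elim by simp
  qed
  then show ?thesis using hat1 \<alpha>\<beta> dep I by blast
qed

end
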